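(* Let $X=[x_1,\dots,x_n]$ be a finite set of vectors in $\mathbb{R}^m$ having an MSS $\{X_1,\dots,X_K\}$ (without pure segment), and put $\mathcal S_k=\mathrm{span}(X_k)$, $d_k=r(X_k)$, $n_k=n(X_k)$, $d=\sum_k d_k$. Assume that (i) $x_j\notin\mathcal S_k\cap\mathcal S_\ell$ for all $j\le n$ and $k\neq\ell$, and (ii) $\{X_1,\dots,X_K\}$ is intersected nondegenerately. If $$d_{\rm int}<d_{\min},\qquad d_0\le d_{\min},\qquad n_k>d_k+(K-1)d_0\ \text{ for all } k,$$ then $\mathcal J(K,d,d_{\min})$ is a singleton, whose unique element is the index partition $J^*=\{J_1^*,\dots,J_K^*\}$ of the MSS, where $J_k^*$ is the set of column indices of $X_k$.
   Context: A real matrix $X=[x_1,\dots,x_n]$ is identified with the (indexed) finite set of its columns; a subset is a column submatrix. $r(X')$ and $n(X')$ denote rank and number of columns, $\mathrm{span}(X')$ the column space, and $X_{J}$ the submatrix of columns indexed by $J\subseteq\{1,\dots,n\}$. $X\setminus X'$ denotes the remaining columns. A set $X'$ is nondegenerate if every subset with rank smaller than $r(X')$ is of full column rank. $\mathrm{span}(X')$ (with its spanning set $X'$) is minimal if $n(X')>r(X')$ and $X'$ is nondegenerate. An MSS (minimal subspace segmentation) of $X$ without pure segment is a partition of the columns of $X$ into nonempty segments $X_1,\dots,X_K$ such that each $\mathrm{span}(X_k)$ is minimal and $\mathrm{span}(X_k)\ne\mathrm{span}(X_\ell)$ for $k\neq\ell$. $\{X_k\}$ is intersected nondegenerately if for every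 $k$ and every subset $X_k'$ of $X\setminus X_k$: with $\mathcal S_k'=\mathrm{span}(X_k)\cap\mathrm{span}(X_k')$ and $\mathcal S_k''$ the orthogonal complement of $\mathcal S_k'$ within $\mathrm{span}(X_k)$, in the columnwise splitting $X_k=Y_k+Z_k$ with columns of $Y_k$ in $\mathcal S_k'$ and of $Z_k$ in $\mathcal S_k''$, $Z_k$ is zero or nondegenerate. Notation: $d_{\min}=\min_k d_k$, $d_0=\max_k\dim\big(\mathcal S_k\cap\sum_{j\ne k}\mathcal S_j\big)$, $d_{\rm int}=\max_{k\neq j}\dim(\mathcal S_k\cap\mathcal S_j)$. $\mathcal J(K,d,d_{\min})$ is the set of all (unordered) partitions $J=\{J_1,\dots,J_K\}$ of $\{1,\dots,n\}$ into $K$ pieces with $\min_k|J_k|>d_{\min}$ and $r(X_{J_1})+\dots+r(X_{J_K})\le d$. *)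

theory Defs
  imports "HOL-Analysis.Analysis" "HOL-Library.Disjoint_Sets"
begin

text \<open>
  A matrix with columns \<open>x\<^sub>1, \<dots>, x\<^sub>n\<close> is the family \<open>x\<close> on the index set \<open>{1..n}\<close>, and the
  submatrix \<open>X\<^sub>J\<close> is the restriction of \<open>x\<close> to \<open>J\<close>. Column counts are cardinalities of
  index sets, so that repeated columns are counted with multiplicity.
\<close>

definition col_space :: "('i \<Rightarrow> 'a::euclidean_space) \<Rightarrow> 'i set \<Rightarrow> 'a set" where
  "col_space x J = span (x ` J)"

definition col_rank :: "('i \<Rightarrow> 'a::euclidean_space) \<Rightarrow> 'i set \<Rightarrow> nat" where
  "col_rank x J = dim (col_space x J)"

definition full_col_rank :: "('i \<Rightarrow> 'a::euclidean_space) \<Rightarrow> 'i set \<Rightarrow> bool" where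
  "full_col_rank x J \<longleftrightarrow> col_rank x J = card J"

definition nondegenerate :: "('i \<Rightarrow> 'a::euclidean_space) \<Rightarrow> 'i set \<Rightarrow> bool" where
  "nondegenerate x J \<longleftrightarrow> (\<forall>J'\<subseteq>J. col_rank x J' < col_rank x J \<longrightarrow> full_col_rank x J')"

definition minimal_span :: "('i \<Rightarrow> 'a::euclidean_space) \<Rightarrow> 'i set \<Rightarrow> bool" where
  "minimal_span x J \<longleftrightarrow> card J > col_rank x J \<and> nondegenerate x J"

text \<open>
  A segmentation of the columns indexed by \<open>I\<close> is given by the unordered partition \<open>P\<close> of \<open>I\<close>
  into the index sets of the segments; the number \<open>K\<close> of segments is \<open>card P\<close>.
\<close>

definition MSS :: "('i \<Rightarrow> 'a::euclidean_space) \<Rightarrow> 'i set \<Rightarrow> 'i set set \<Rightarrow> bool" where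
  "MSS x I P \<longleftrightarrow> partition_on I P \<and> (\<forall>A\<in>P. minimal_span x A) \<and>
     (\<forall>A\<in>P. \<forall>B\<in>P. A \<noteq> B \<longrightarrow> col_space x A \<noteq> col_space x B)"

definition orth_compl_within :: "'a::euclidean_space set \<Rightarrow> 'a set \<Rightarrow> 'a set" where
  "orth_compl_within S T = {v \<in> S. \<forall>w\<in>T. orthogonal v w}"

text \<open>
  The splitting \<open>x = y + z\<close> in the following definition always exists and is unique on \<open>A\<close>.
\<close>

definition intersected_nondegenerately ::
    "('i \<Rightarrow> 'a::euclidean_space) \<Rightarrow> 'i set \<Rightarrow> 'i set set \<Rightarrow> bool" where
  "intersected_nondegenerately x I P \<longleftrightarrow>
     (\<forall>A\<in>P. \<forall>B\<subseteq>I - A. \<forall>y z.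
        (\<forall>j\<in>A. x j = y j + z j \<and>
           y j \<in> col_space x A \<inter> col_space x B \<and>
           z j \<in> orth_compl_within (col_space x A) (col_space x A \<inter> col_space x B)) \<longrightarrow>
        (\<forall>j\<in>A. z j = 0) \<or> nondegenerate z A)"

definition d_min :: "('i \<Rightarrow> 'a::euclidean_space) \<Rightarrow> 'i set set \<Rightarrow> nat" where
  "d_min x P = Min (col_rank x ` P)"

text \<open>The span of the union below is the sum of the subspaces of the other segments.\<close>

definition d_zero :: "('i \<Rightarrow> 'a::euclidean_space) \<Rightarrow> 'i set set \<Rightarrow> nat" where
  "d_zero x P = Max ((\<lambda>A. dim (col_space x A \<inter> span (\<Union>B\<in>P - {A}. col_space x B))) ` P)"

text \<open>The inserted \<open>0\<close> only matters for a single segment, where there are no pairs.\<close>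

definition d_int :: "('i \<Rightarrow> 'a::euclidean_space) \<Rightarrow> 'i set set \<Rightarrow> nat" where
  "d_int x P = Max (insert 0
     {dim (col_space x A \<inter> col_space x B) | A B. A \<in> P \<and> B \<in> P \<and> A \<noteq> B})"

definition low_rank_partitions ::
    "('i \<Rightarrow> 'a::euclidean_space) \<Rightarrow> 'i set \<Rightarrow> nat \<Rightarrow> nat \<Rightarrow> nat \<Rightarrow> 'i set set set" where
  "low_rank_partitions x I K d s =
     {Q. partition_on I Q \<and> card Q = K \<and> (\<forall>J\<in>Q. card J > s) \<and> (\<Sum>J\<in>Q. col_rank x J) \<le> d}"

end

theory Submission
  imports Defs
begin

text \<open>
  Given a competing partition \<open>Q\<close>, build each \<open>J \<in> Q\<close> by adding the pieces \<open>J \<inter> A\<close>, \<open>A \<in> P\<close>,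
  one at a time. By nondegenerate intersection each step raises the rank by at least
  \<open>min |J \<inter> A| (d\<^sub>A - s)\<close>, where \<open>s \<le> d\<^sub>0\<close> is the dimension of the overlap of the space of \<open>A\<close> with
  what is already there. Call \<open>A\<close> saturated in \<open>J\<close> if the second term is the smaller one. If some \<open>A\<close>
  is saturated in no \<open>J\<close>, its \<open>n\<^sub>A > d\<^sub>A + (K - 1) d\<^sub>0\<close> columns all count and the total rank exceeds \<open>d\<close>.
  Otherwise a double count of the saturated pairs forces equality everywhere, and the equality
  cases leave exactly one saturated \<open>A\<close> in each \<open>J\<close>, with \<open>J \<subseteq> A\<close>.
\<close>

section \<open>Column spaces, column ranks and orthogonal splittings\<close>

lemma subspace_col_space [simp]: "subspace (col_space x J)"
  by (simp add: col_space_def)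

lemma col_space_mono: "J \<subseteq> J' \<Longrightarrow> col_space x J \<subseteq> col_space x J'"
  by (simp add: col_space_def image_mono span_mono)

lemma col_space_base: "j \<in> J \<Longrightarrow> x j \<in> col_space x J"
  by (simp add: col_space_def span_base)

lemma col_rank_eq: "col_rank x J = dim (x ` J)"
  by (simp add: col_rank_def col_space_def)

text \<open>Either \<open>D\<close> already reaches the rank of \<open>A\<close>, or nondegeneracy
  makes its columns independent.\<close>

lemma col_rank_nondegenerate_ge:
  assumes "nondegenerate z A" "D \<subseteq> A"
  shows "min (card D) (col_rank z A) \<le> col_rank z D"
  using assms unfolding nondegenerate_def full_col_rank_def
  by (metis linorder_not_le min.cobounded1 min.cobounded2 order_trans)

lemma orthogonal_splitting_exists:
  assumes S: "subspace S" and T: "subspace T" "T \<subseteq> S" and "v \<in> S"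
  shows "\<exists>y z. v = y + z \<and> y \<in> T \<and> z \<in> orth_compl_within S T"
proof -
  obtain y z where yz: "y \<in> span T" "\<And>w. w \<in> span T \<Longrightarrow> orthogonal z w" "v = y + z"
    using orthogonal_subspace_decomp_exists [of T v] by metis
  have "y \<in> T" using yz(1) T by (metis span_eq_iff)
  moreover have "z = v - y" using yz by simp
  then have "z \<in> S" using \<open>y \<in> T\<close> assms by (auto intro: subspace_diff)
  ultimately show ?thesis
    using yz unfolding orth_compl_within_def by (blast intro: span_base)
qed

lemma subspace_orth_compl_within: "subspace S \<Longrightarrow> subspace (orth_compl_within S T)"
  by (auto simp: subspace_def orth_compl_within_def orthogonal_clauses orthogonal_def inner_add_left)

section \<open>Rank growth when columns of one segment are added\<close>

lemma col_rank_Un_ge: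
  fixes x :: "'i \<Rightarrow> 'a::euclidean_space"
  assumes nd: "intersected_nondegenerately x I P" and A: "A \<in> P" and B: "B \<subseteq> I - A" and D: "D \<subseteq> A"
  shows "col_rank x B + min (card D) (col_rank x A - dim (col_space x A \<inter> col_space x B))
           \<le> col_rank x (B \<union> D)"
proof -
  define S where "S = col_space x A"
  define T where "T = S \<inter> col_space x B"
  have ST: "subspace S" "subspace T" "T \<subseteq> S"
    by (auto simp: S_def T_def intro: subspace_inter)
  have "\<forall>j\<in>A. \<exists>y z. x j = y + z \<and> y \<in> T \<and> z \<in> orth_compl_within S T"
    using orthogonal_splitting_exists [OF ST] by (simp add: S_def col_space_base)
  then obtain y z where yz: "\<forall>j\<in>A. x j = y j + z j \<and> y j \<in> T \<and> z j \<in> orth_compl_within S T"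
    by metis
  have sumdim: "dim {u + v |u v. u \<in> U \<and> v \<in> V} + dim (U \<inter> V) = dim U + dim V"
    if "subspace U" "subspace V" for U V :: "'a set"
    using dim_sums_Int [OF that] .
  have "x ` A \<subseteq> {u + v |u v. u \<in> T \<and> v \<in> span (z ` A)}"
    using yz by (fastforce intro: span_base)
  then have "dim (x ` A) \<le> dim {u + v |u v. u \<in> T \<and> v \<in> span (z ` A)}"
    by (rule dim_subset)
  then have rkz: "col_rank x A - dim T \<le> col_rank z A"
    using sumdim [of T "span (z ` A)"] ST by (simp add: col_rank_eq)
  have "(\<forall>j\<in>A. z j = 0) \<or> nondegenerate z A"
    using nd A B yz unfolding intersected_nondegenerately_def S_def T_def by blast
  then have zD: "min (card D) (col_rank x A - dim T) \<le> col_rank z D"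
  proof
    assume "\<forall>j\<in>A. z j = 0"
    then have "z ` A \<subseteq> {0}" by auto
    then have "dim (z ` A) = 0" using dim_eq_0 by blast
    then have "col_rank x A - dim T = 0" using rkz unfolding col_rank_eq by linarith
    then show ?thesis by simp
  next
    assume "nondegenerate z A"
    from col_rank_nondegenerate_ge [OF this D] rkz show ?thesis by linarith
  qed
  have "span (z ` D) \<subseteq> orth_compl_within S T"
    using yz D by (intro span_minimal subspace_orth_compl_within ST) auto
  \<comment> \<open>A common vector lies in \<open>S\<close>, hence in \<open>T\<close>, while being
    orthogonal to all of \<open>T\<close>; so it is orthogonal to itself.\<close>
  then have "col_space x B \<inter> span (z ` D) \<subseteq> {0}"
    by (fastforce simp: T_def orth_compl_within_def orthogonal_self [symmetric])
  then have int0: "dim (col_space x B \<inter> span (z ` D)) = 0"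
    using dim_eq_0 by blast
  \<comment> \<open>Since \<open>y j\<close> lies in \<open>col_space x B\<close>, replacing
    \<open>x j\<close> by \<open>z j\<close> does not leave the space of
    \<open>B \<union> D\<close>. The ranks of \<open>B\<close> and of the \<open>z\<close>-parts of
    \<open>D\<close> therefore add up inside it.\<close>
  have zmem: "z j \<in> col_space x (B \<union> D)" if "j \<in> D" for j
  proof -
    have "y j \<in> col_space x (B \<union> D)"
      using yz D that col_space_mono [of B "B \<union> D" x] by (auto simp: T_def)
    moreover have "z j = x j - y j" using yz D that by auto
    ultimately show ?thesis
      using that by (auto intro: subspace_diff col_space_base)
  qed
  then have "span (z ` D) \<subseteq> col_space x (B \<union> D)"
    by (intro span_minimal) auto
  then have "{u + v |u v. u \<in> col_space x B \<and> v \<in> span (z ` D)} \<subseteq> col_space x (B \<union> D)"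
    using col_space_mono [of B "B \<union> D" x] by (auto intro!: subspace_add)
  then have "dim {u + v |u v. u \<in> col_space x B \<and> v \<in> span (z ` D)} \<le> col_rank x (B \<union> D)"
    unfolding col_rank_def by (rule dim_subset)
  then have "col_rank x B + col_rank z D \<le> col_rank x (B \<union> D)"
    using sumdim [of "col_space x B" "span (z ` D)"] int0
    unfolding col_rank_def [of x] col_rank_eq [of z] by (simp del: dim_eq_0)
  with zD show ?thesis by (simp add: S_def T_def)
qed

section \<open>Bounds on the overlaps of segments\<close>

lemma dim_Int_le_d_int:
  assumes "finite P" "A \<in> P" "B \<in> P" "A \<noteq> B"
  shows "dim (col_space x A \<inter> col_space x B) \<le> d_int x P"
proof -
  let ?D = "{dim (col_space x A \<inter> col_space x B) | A B. A \<in> P \<and> B \<in> P \<and> A \<noteq> B}"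
  have "?D \<subseteq> (\<lambda>(A, B). dim (col_space x A \<inter> col_space x B)) ` (P \<times> P)" by auto
  then have "finite ?D" using assms(1) by (meson finite_SigmaI finite_imageI finite_subset)
  then show ?thesis
    unfolding d_int_def using assms by (intro Max_ge) auto
qed

text \<open>Meant for the columns \<open>B\<close> already collected from other segments when
  \<open>A\<close> is taken up.\<close>

lemma dim_Int_le_d_zero:
  assumes "finite P" "A \<in> P" "B \<subseteq> \<Union>(P - {A})"
  shows "dim (col_space x A \<inter> col_space x B) \<le> d_zero x P"
proof -
  have "x ` B \<subseteq> (\<Union>C\<in>P - {A}. col_space x C)"
    using assms(3) by (fastforce intro: col_space_base)
  then have "col_space x B \<subseteq> span (\<Union>C\<in>P - {A}. col_space x C)"
    unfolding col_space_def by (rule span_mono)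
  then have "dim (col_space x A \<inter> col_space x B)
      \<le> dim (col_space x A \<inter> span (\<Union>C\<in>P - {A}. col_space x C))"
    by (intro dim_subset) auto
  also have "\<dots> \<le> d_zero x P"
    unfolding d_zero_def using assms by (intro Max_ge) auto
  finally show ?thesis .
qed

section \<open>Saturated segments of a single index set\<close>

lemma Int_Union_insert: "T \<inter> \<Union>(insert C R) = (T \<inter> \<Union>R) \<union> (T \<inter> C)"
  by blast

text \<open>
  What the proof needs to know of the set \<open>F\<close> of segments from \<open>R\<close> that are saturated in \<open>T\<close>.
  The last two clauses record the equality cases.
\<close>

definition saturated ::
    "('i \<Rightarrow> 'a::euclidean_space) \<Rightarrow> 'i set set \<Rightarrow> 'i set \<Rightarrow> 'i set set \<Rightarrow> 'i set set \<Rightarrow> bool" where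
  "saturated x P T R F \<longleftrightarrow> F \<subseteq> R \<and>
    (\<Sum>A\<in>F. col_rank x A) + (\<Sum>A\<in>R - F. card (T \<inter> A)) \<le> col_rank x (T \<inter> \<Union>R) + card F * d_zero x P \<and>
    (F \<noteq> {} \<longrightarrow> (\<Sum>A\<in>F. col_rank x A) + d_zero x P \<le> col_rank x (T \<inter> \<Union>R) + card F * d_zero x P) \<and>
    (\<forall>A. F = {A} \<longrightarrow> col_rank x (T \<inter> \<Union>R) = col_rank x A \<longrightarrow> T \<inter> \<Union>R \<subseteq> A) \<and>
    (card F \<ge> 2 \<longrightarrow> d_int x P < d_zero x P \<longrightarrow>
      (\<Sum>A\<in>F. col_rank x A) + d_zero x P < col_rank x (T \<inter> \<Union>R) + card F * d_zero x P)"

text \<open>Induction on \<open>R\<close>, where \<open>col_rank_Un_ge\<close> bounds the gain from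
  each new segment \<open>C\<close>. The equality clauses have to be carried along: strictness for
  two saturated segments rests on the inclusion clause for one.\<close>

lemma saturated_segments_exist:
  assumes fin: "finite I" and part: "partition_on I P"
    and nomix: "\<forall>j\<in>I. \<forall>A\<in>P. \<forall>B\<in>P. A \<noteq> B \<longrightarrow> x j \<notin> col_space x A \<inter> col_space x B"
    and nd: "intersected_nondegenerately x I P"
    and T: "T \<subseteq> I" and R: "R \<subseteq> P"
  shows "\<exists>F. saturated x P T R F"
proof -
  have finP: "finite P" using fin part finite_elements by blast
  then have "finite R" using R finite_subset by blast
  from this R show ?thesis
  proof (induction R rule: finite_induct)
    case empty
    have "saturated x P T {} {}" by (simp add: saturated_def)
    then show ?case ..
  next
    case (insert C R)
    define d0 where "d0 = d_zero x P"
    define B where "B = T \<inter> \<Union>R"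
    define r where "r = col_rank x B"
    define r' where "r' = col_rank x (T \<inter> \<Union>(insert C R))"
    define s where "s = dim (col_space x C \<inter> col_space x B)"
    from insert obtain F where sat: "saturated x P T R F" by auto
    from sat have F: "F \<subseteq> R"
      and F1: "(\<Sum>A\<in>F. col_rank x A) + (\<Sum>A\<in>R - F. card (T \<inter> A)) \<le> r + card F * d0"
      and F2: "F \<noteq> {} \<Longrightarrow> (\<Sum>A\<in>F. col_rank x A) + d0 \<le> r + card F * d0"
      and F3: "\<And>A. F = {A} \<Longrightarrow> r = col_rank x A \<Longrightarrow> B \<subseteq> A"
      and F4: "card F \<ge> 2 \<Longrightarrow> d_int x P < d0 \<Longrightarrow> (\<Sum>A\<in>F. col_rank x A) + d0 < r + card F * d0"
      unfolding saturated_def r_def B_def d0_def by simp_all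
    have C: "C \<in> P" "C \<notin> R" and RP: "R \<subseteq> P" using insert by auto
    have dj: "A \<inter> C = {}" if "A \<in> R" for A
      using disjointD [OF partition_onD2 [OF part]] that C RP by blast
    have BC: "B \<subseteq> I - C" using dj T by (auto simp: B_def)
    have r': "r' = col_rank x (B \<union> (T \<inter> C))"
      unfolding r'_def B_def Int_Union_insert ..
    have step: "r + min (card (T \<inter> C)) (col_rank x C - s) \<le> r'"
      unfolding r' r_def s_def using col_rank_Un_ge [OF nd C(1) BC] by blast
    have sd0: "s \<le> d0"
      unfolding s_def d0_def B_def using RP C by (intro dim_Int_le_d_zero finP) auto
    have sdC: "s \<le> col_rank x C"
      unfolding s_def col_rank_def by (intro dim_subset) auto
    have sr: "s \<le> r"
      unfolding s_def r_def col_rank_def by (intro dim_subset) auto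
    have finF: "finite F" using F insert.hyps finite_subset by blast
    have CF: "C \<notin> F" using F C by auto
    have finTC: "finite (T \<inter> C)" using T fin finite_subset by blast
    \<comment> \<open>In the first case \<open>F\<close> is kept; in the second \<open>C\<close>
      joins it, and the gain is at least \<open>col_rank x C - s\<close>, with \<open>s\<close> at
      most \<open>d0\<close>.\<close>
    show ?case
    proof (cases "card (T \<inter> C) \<le> col_rank x C - s")
      case True
      with step have st: "r + card (T \<inter> C) \<le> r'" by simp
      have "insert C R - F = insert C (R - F)" using CF by auto
      then have sm: "(\<Sum>A\<in>insert C R - F. card (T \<inter> A)) = card (T \<inter> C) + (\<Sum>A\<in>R - F. card (T \<inter> A))"
        using insert.hyps by simp
      \<comment> \<open>The rank was at least \<open>col_rank x A\<close> before \<open>C\<close>,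
        so equality now leaves no room for columns from \<open>C\<close>.\<close>
      have eq: "T \<inter> \<Union>(insert C R) \<subseteq> A" if FA: "F = {A}" and rA: "r' = col_rank x A" for A
      proof -
        have "col_rank x A \<le> r" using F2 FA by simp
        then have "card (T \<inter> C) = 0" "r = col_rank x A" using st rA by auto
        then have "T \<inter> C = {}" "B \<subseteq> A" using F3 [OF FA] finTC by auto
        then show ?thesis by (auto simp: B_def)
      qed
      show ?thesis
        unfolding saturated_def r'_def [symmetric] d0_def [symmetric]
      proof (intro exI [of _ F] conjI impI allI)
        show "F \<subseteq> insert C R" using F by blast
      qed (use F1 F2 F4 st eq sm in fastforce)+
    next
      case False
      with step have "r + (col_rank x C - s) \<le> r'" by simp
      then have st: "r + col_rank x C \<le> r' + s" using sdC by simp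
      have "insert C R - insert C F = R - F" using C by auto
      moreover have "(\<Sum>A\<in>insert C F. col_rank x A) = col_rank x C + (\<Sum>A\<in>F. col_rank x A)"
        using CF finF by simp
      moreover have cardF: "card (insert C F) = Suc (card F)"
        using CF finF by simp
      ultimately have
        g1: "(\<Sum>A\<in>insert C F. col_rank x A) + (\<Sum>A\<in>insert C R - insert C F. card (T \<inter> A))
           \<le> r' + card (insert C F) * d0"
        using F1 st sd0 by simp
      \<comment> \<open>The first saturated segment loses nothing: for empty \<open>F\<close>, the
        overlap \<open>s\<close> is at most the rank \<open>r\<close> already present, so
        \<open>r'\<close> is at least \<open>col_rank x C\<close>.\<close>
      have g2: "(\<Sum>A\<in>insert C F. col_rank x A) + d0 \<le> r' + card (insert C F) * d0"
        using F2 st sd0 sr CF finF by (cases "F = {}") simp_all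
      \<comment> \<open>Equality forces the space of \<open>B\<close> into that of \<open>C\<close>.
        A column of \<open>B\<close> would then lie in the spaces of two segments, which
        \<open>nomix\<close> excludes.\<close>
      have g3: "T \<inter> \<Union>(insert C R) \<subseteq> A" if FA: "insert C F = {A}" and rA: "r' = col_rank x A" for A
      proof -
        have AC: "A = C" "F = {}" using FA CF by auto
        then have "r \<le> s" using st rA by simp
        then have "dim (col_space x B) \<le> dim (col_space x C \<inter> col_space x B)"
          by (simp add: r_def s_def col_rank_def)
        then have "col_space x C \<inter> col_space x B = col_space x B"
          by (intro subspace_dim_equal) (auto intro: subspace_inter)
        then have sub: "col_space x B \<subseteq> col_space x C" by auto
        have "B = {}"
        proof (rule ccontr)
          assume "B \<noteq> {}"
          then obtain j A where j: "j \<in> B" "A \<in> R" "j \<in> A" by (auto simp: B_def)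
          then have "x j \<in> col_space x A \<inter> col_space x C"
            using sub by (auto intro: col_space_base)
          then show False using nomix j BC RP C by blast
        qed
        then show ?thesis using AC by (auto simp: B_def)
      qed
      have g4: "(\<Sum>A\<in>insert C F. col_rank x A) + d0 < r' + card (insert C F) * d0"
        if c2: "card (insert C F) \<ge> 2" and di: "d_int x P < d0"
      proof (cases "card F \<ge> 2")
        case True
        then show ?thesis using F4 di st sd0 CF finF by simp
      next
        case False
        then have "card F = 1" using c2 cardF by simp
        then obtain A where FA: "F = {A}" by (rule card_1_singletonE)
        \<comment> \<open>Strictness is gained here: if \<open>r\<close> has no slack, the inclusion
          clause puts \<open>B\<close> inside \<open>A\<close>, so that \<open>s\<close> is at most
          \<open>d_int x P\<close> and hence below \<open>d0\<close>.\<close>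
        have "r > col_rank x A \<or> s < d0"
        proof (cases "r = col_rank x A")
          case True
          then have "col_space x B \<subseteq> col_space x A" using F3 [OF FA] by (intro col_space_mono)
          then have "s \<le> dim (col_space x C \<inter> col_space x A)"
            unfolding s_def by (intro dim_subset) auto
          also have "\<dots> \<le> d_int x P"
            using FA F C RP by (intro dim_Int_le_d_int finP) auto
          finally show ?thesis using di by simp
        next
          case False
          then show ?thesis using F2 FA by simp
        qed
        moreover have "A \<noteq> C" using FA CF by auto
        moreover have "col_rank x A \<le> r" using F2 FA by simp
        ultimately show ?thesis using st sd0 FA by auto
      qed
      show ?thesis
        unfolding saturated_def r'_def [symmetric] d0_def [symmetric]
        by (intro exI [of _ "insert C F"] conjI impI allI insert_mono F g1 g2 g3 g4)
    qed
  qed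
qed

section \<open>Combinatorics of partitions\<close>

lemma partition_on_card_Int_sum:
  assumes "finite I" "partition_on I Q" "A \<subseteq> I"
  shows "(\<Sum>J\<in>Q. card (J \<inter> A)) = card A"
proof -
  have "A = (\<Union>J\<in>Q. J \<inter> A)" using assms(2,3) by (auto simp: partition_on_def)
  also have "card \<dots> = (\<Sum>J\<in>Q. card (J \<inter> A))"
    using assms unfolding partition_on_def disjoint_def
    by (intro card_UN_disjoint) (auto intro: finite_elements [OF assms(1,2)] finite_subset)
  finally show ?thesis ..
qed

text \<open>Sending each block of \<open>Q\<close> to the block of \<open>P\<close> around it is
  onto, as blocks of \<open>P\<close> are nonempty. The cardinality bound makes it injective, so no
  block of \<open>P\<close> is split.\<close>

lemma partition_on_refine_eq:
  assumes fin: "finite I" and P: "partition_on I P" and Q: "partition_on I Q"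
    and card: "card Q \<le> card P" and ref: "\<And>J. J \<in> Q \<Longrightarrow> \<exists>A\<in>P. J \<subseteq> A"
  shows "Q = P"
proof -
  have finP: "finite P" and finQ: "finite Q" using fin P Q finite_elements by blast+
  obtain f where f: "\<And>J. J \<in> Q \<Longrightarrow> f J \<in> P \<and> J \<subseteq> f J" using ref by metis
  have uniq: "A = f J" if "A \<in> P" "J \<in> Q" "a \<in> A" "a \<in> J" for A J a
    using f [OF that(2)] that P by (auto simp: partition_on_def disjoint_def)
  have surj: "P \<subseteq> f ` Q"
  proof
    fix A assume A: "A \<in> P"
    then have "A \<noteq> {}" using P by (auto simp: partition_on_def)
    then obtain a where a: "a \<in> A" by blast
    then obtain J where "J \<in> Q" "a \<in> J" using A P Q by (auto simp: partition_on_def)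
    then show "A \<in> f ` Q" using uniq A a by blast
  qed
  then have "f ` Q = P" using f by auto
  then have inj: "inj_on f Q"
    using card finQ card_image_le [OF finQ, of f] by (intro eq_card_imp_inj_on) auto
  have "f J = J" if J: "J \<in> Q" for J
  proof
    show "f J \<subseteq> J"
    proof
      fix a assume a: "a \<in> f J"
      then have "a \<in> \<Union>Q" using f [OF J] P Q by (auto simp: partition_on_def)
      then obtain J' where J': "J' \<in> Q" "a \<in> J'" by blast
      then have "f J = f J'" using uniq a f [OF J] by blast
      then show "a \<in> J" using inj J J' by (auto dest: inj_onD)
    qed
  qed (use f J in blast)
  then show ?thesis using \<open>f ` Q = P\<close> by simp
qed

section \<open>Double counting over a competing partition\<close>

lemma low_rank_partition_unique:
  fixes x :: "'i \<Rightarrow> 'a::euclidean_space"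
  assumes fin: "finite I" and part: "partition_on I P"
    and nomix: "\<forall>j\<in>I. \<forall>A\<in>P. \<forall>B\<in>P. A \<noteq> B \<longrightarrow> x j \<notin> col_space x A \<inter> col_space x B"
    and nd: "intersected_nondegenerately x I P"
    and di: "d_int x P < d_min x P"
    and dz: "d_zero x P \<le> d_min x P"
    and big: "\<forall>A\<in>P. card A > col_rank x A + (card P - 1) * d_zero x P"
    and Q: "partition_on I Q" "card Q = card P" "\<forall>J\<in>Q. card J > d_min x P"
      "(\<Sum>J\<in>Q. col_rank x J) \<le> (\<Sum>A\<in>P. col_rank x A)"
  shows "Q = P"
proof -
  have finP: "finite P" and finQ: "finite Q" using fin part Q finite_elements by blast+
  \<comment> \<open>Integers avoid truncated subtraction in the signed sums below.\<close>
  define d0 where "d0 = int (d_zero x P)"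
  define \<rho> where "\<rho> = (\<lambda>J. int (col_rank x J))"
  have dmin: "d_min x P \<le> col_rank x A" if "A \<in> P" for A
    unfolding d_min_def using finP that by (intro Min_le) auto
  then have le: "d_zero x P \<le> col_rank x A" if "A \<in> P" for A
    using dz that order_trans by blast
  have QI: "J \<subseteq> I" if "J \<in> Q" for J using Q(1) that by (auto simp: partition_on_def)
  have JU: "J \<inter> \<Union>P = J" if "J \<in> Q" for J
    using QI [OF that] part by (auto simp: partition_on_def)
  have "\<exists>F. saturated x P J P F" if "J \<in> Q" for J
    by (rule saturated_segments_exist [OF fin part nomix nd QI [OF that] subset_refl])
  then obtain F where sat: "\<And>J. J \<in> Q \<Longrightarrow> saturated x P J P (F J)" by metis
  have FP: "\<And>J. J \<in> Q \<Longrightarrow> F J \<subseteq> P"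
    and F1: "\<And>J. J \<in> Q \<Longrightarrow> (\<Sum>A\<in>F J. col_rank x A) + (\<Sum>A\<in>P - F J. card (J \<inter> A))
                 \<le> col_rank x J + card (F J) * d_zero x P"
    and F2: "\<And>J. J \<in> Q \<Longrightarrow> F J \<noteq> {} \<Longrightarrow> (\<Sum>A\<in>F J. col_rank x A) + d_zero x P
                 \<le> col_rank x J + card (F J) * d_zero x P"
    and F3: "\<And>J A. J \<in> Q \<Longrightarrow> F J = {A} \<Longrightarrow> col_rank x J = col_rank x A \<Longrightarrow> J \<subseteq> A"
    and F4: "\<And>J. J \<in> Q \<Longrightarrow> card (F J) \<ge> 2 \<Longrightarrow> d_int x P < d_zero x P \<Longrightarrow>
       (\<Sum>A\<in>F J. col_rank x A) + d_zero x P < col_rank x J + card (F J) * d_zero x P"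
    using sat JU unfolding saturated_def by fastforce+
  have finF: "finite (F J)" if "J \<in> Q" for J using FP [OF that] finP finite_subset by blast
  have sumF: "(\<Sum>A\<in>F J. \<rho> A - d0) = int (\<Sum>A\<in>F J. col_rank x A) - int (card (F J) * d_zero x P)" for J
    by (simp add: \<rho>_def d0_def sum_subtractf)
  have tot: "(\<Sum>J\<in>Q. \<rho> J) \<le> (\<Sum>A\<in>P. \<rho> A)"
    using Q(4) unfolding \<rho>_def by (metis of_nat_le_iff of_nat_sum)
  have d0le: "d0 \<le> \<rho> A" if "A \<in> P" for A using le [OF that] by (simp add: d0_def \<rho>_def)
  define m where "m = (\<lambda>A. card {J \<in> Q. A \<in> F J})"
  have m1: "m A \<ge> 1" if A: "A \<in> P" for A
  proof (rule ccontr)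
    assume "\<not> m A \<ge> 1"
    then have A0: "A \<notin> F J" if "J \<in> Q" for J using that finQ by (auto simp: m_def Suc_le_eq card_gt_0_iff)
    \<comment> \<open>The rank that \<open>J \<inter> B\<close> is sure to contribute to
      \<open>J\<close>. Rows sum to at most \<open>\<rho> J\<close>; columns are bounded below by
      \<open>\<rho> B - d0\<close>, with a large surplus for a segment saturated nowhere.\<close>
    define g where "g = (\<lambda>J B. if B \<in> F J then \<rho> B - d0 else int (card (J \<inter> B)))"
    have g0: "g J B \<ge> 0" if "B \<in> P" for J B using d0le [OF that] by (simp add: g_def)
    have row: "(\<Sum>B\<in>P. g J B) \<le> \<rho> J" if J: "J \<in> Q" for J
    proof -
      have "(\<Sum>B\<in>P. g J B) = (\<Sum>B\<in>P - F J. g J B) + (\<Sum>B\<in>F J. g J B)"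
        by (rule sum.subset_diff [OF FP [OF J] finP])
      also have "\<dots> = (\<Sum>B\<in>P - F J. int (card (J \<inter> B))) + (\<Sum>B\<in>F J. \<rho> B - d0)"
        by (intro arg_cong2 [where f = "(+)"] sum.cong) (auto simp: g_def)
      also have "(\<Sum>B\<in>P - F J. int (card (J \<inter> B))) = int (\<Sum>B\<in>P - F J. card (J \<inter> B))"
        by simp
      finally show ?thesis using F1 [OF J] unfolding sumF unfolding \<rho>_def by linarith
    qed
    have unsat: "(\<Sum>J\<in>Q. g J B) > \<rho> B + int (card P - 1) * d0"
      if B: "B \<in> P" and none: "\<And>J. J \<in> Q \<Longrightarrow> B \<notin> F J" for B
    proof -
      have "B \<subseteq> I" using B part by (auto simp: partition_on_def)
      then have "(\<Sum>J\<in>Q. int (card (J \<inter> B))) = int (card B)"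
        using partition_on_card_Int_sum [OF fin Q(1)] by (metis of_nat_sum)
      moreover have "(\<Sum>J\<in>Q. g J B) = (\<Sum>J\<in>Q. int (card (J \<inter> B)))"
        using none by (intro sum.cong) (auto simp: g_def)
      moreover have "int (card B) > int (col_rank x B + (card P - 1) * d_zero x P)"
        using big B by (simp only: of_nat_less_iff)
      ultimately show ?thesis by (simp add: \<rho>_def d0_def)
    qed
    have col: "\<rho> B - d0 \<le> (\<Sum>J\<in>Q. g J B)" if B: "B \<in> P" for B
    proof (cases "\<exists>J\<in>Q. B \<in> F J")
      case True
      then obtain J where J: "J \<in> Q" "B \<in> F J" by blast
      then have "g J B \<le> (\<Sum>J\<in>Q. g J B)" using finQ g0 [OF B] by (intro member_le_sum) auto
      then show ?thesis using J by (simp add: g_def)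
    next
      case False
      then have "\<rho> B + int (card P - 1) * d0 < (\<Sum>J\<in>Q. g J B)" using unsat [OF B] by blast
      moreover have "0 \<le> int (card P - 1) * d0" "0 \<le> d0" by (auto simp: d0_def)
      ultimately show ?thesis by linarith
    qed
    \<comment> \<open>The surplus of \<open>A\<close> pays for the \<open>d0\<close> lost on each of
      the \<open>card P - 1\<close> other segments.\<close>
    have "(\<Sum>B\<in>P. \<rho> B) = \<rho> A + (\<Sum>B\<in>P - {A}. \<rho> B)"
      using finP A by (simp add: sum.remove)
    also have "(\<Sum>B\<in>P - {A}. \<rho> B) = (\<Sum>B\<in>P - {A}. \<rho> B - d0) + int (card P - 1) * d0"
      using finP A by (simp add: sum_subtractf card_Diff_singleton)
    also have "(\<Sum>B\<in>P - {A}. \<rho> B - d0) \<le> (\<Sum>B\<in>P - {A}. \<Sum>J\<in>Q. g J B)"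
      by (intro sum_mono col) auto
    finally have "(\<Sum>B\<in>P. \<rho> B) < (\<Sum>J\<in>Q. g J A) + (\<Sum>B\<in>P - {A}. \<Sum>J\<in>Q. g J B)"
      using unsat [OF A A0] by linarith
    also have "\<dots> = (\<Sum>B\<in>P. \<Sum>J\<in>Q. g J B)"
      using finP A by (simp add: sum.remove)
    also have "\<dots> = (\<Sum>J\<in>Q. \<Sum>B\<in>P. g J B)" by (rule sum.swap)
    also have "\<dots> \<le> (\<Sum>J\<in>Q. \<rho> J)" by (intro sum_mono row)
    finally show False using tot by simp
  qed
  have swap: "(\<Sum>J\<in>Q. \<Sum>A\<in>F J. g A) = (\<Sum>A\<in>P. int (m A) * g A)" for g :: "'i set \<Rightarrow> int"
  proof -
    have "(\<Sum>J\<in>Q. \<Sum>A\<in>F J. g A) = (\<Sum>J\<in>Q. \<Sum>A | A \<in> P \<and> A \<in> F J. g A)"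
      using FP by (intro sum.cong) auto
    also have "\<dots> = (\<Sum>A\<in>P. \<Sum>J | J \<in> Q \<and> A \<in> F J. g A)"
      by (rule sum.swap_restrict [OF finQ finP])
    finally show ?thesis by (simp add: m_def)
  qed
  \<comment> \<open>The slack of the second clause of \<open>saturated\<close>. If
    \<open>F J\<close> is empty, the columns of \<open>J\<close> are independent and number more
    than \<open>d_min x P\<close>, hence more than \<open>d0\<close>, so the slack is
    positive.\<close>
  define e where "e = (\<lambda>J. \<rho> J - d0 - (\<Sum>A\<in>F J. \<rho> A - d0))"
  have epos: "e J > 0" if J: "J \<in> Q" "F J = {}" for J
  proof -
    have "card J \<le> col_rank x J"
      using F1 [OF J(1)] J(2) partition_on_card_Int_sum [OF fin part QI [OF J(1)]]
      by (simp add: Int_commute)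
    then have "d_zero x P < col_rank x J" using Q(3) J dz by force
    then show ?thesis using J by (simp add: e_def \<rho>_def d0_def)
  qed
  have e0: "e J \<ge> 0" if J: "J \<in> Q" for J
  proof (cases "F J = {}")
    case False
    from F2 [OF J this] show ?thesis unfolding e_def sumF unfolding \<rho>_def d0_def by linarith
  qed (use epos [OF J] in simp)
  have mm0: "(int (m A) - 1) * (\<rho> A - d0) \<ge> 0" if "A \<in> P" for A
    using m1 [OF that] d0le [OF that] by simp
  \<comment> \<open>As \<open>card Q = card P\<close>, everything cancels except total rank of
    \<open>Q\<close> minus total rank of \<open>P\<close>, which is at most 0. All terms on the left
    are nonnegative, so each vanishes.\<close>
  have "(\<Sum>J\<in>Q. e J) + (\<Sum>A\<in>P. (int (m A) - 1) * (\<rho> A - d0))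
      = (\<Sum>J\<in>Q. \<rho> J) - int (card Q) * d0 - (\<Sum>A\<in>P. int (m A) * (\<rho> A - d0))
        + (\<Sum>A\<in>P. int (m A) * (\<rho> A - d0)) - ((\<Sum>A\<in>P. \<rho> A) - int (card P) * d0)"
    unfolding e_def sum_subtractf [of _ "\<lambda>J. \<Sum>A\<in>F J. _ A"] swap
    by (simp add: sum_subtractf left_diff_distrib)
  then have "(\<Sum>J\<in>Q. e J) + (\<Sum>A\<in>P. (int (m A) - 1) * (\<rho> A - d0)) \<le> 0"
    using tot Q(2) by simp
  moreover have "(\<Sum>J\<in>Q. e J) \<ge> 0" "(\<Sum>A\<in>P. (int (m A) - 1) * (\<rho> A - d0)) \<ge> 0"
    using e0 mm0 by (auto intro: sum_nonneg)
  ultimately have "(\<Sum>J\<in>Q. e J) = 0" "(\<Sum>A\<in>P. (int (m A) - 1) * (\<rho> A - d0)) = 0" by auto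
  then have eJ: "\<And>J. J \<in> Q \<Longrightarrow> e J = 0"
    and mA: "\<And>A. A \<in> P \<Longrightarrow> m A = 1 \<or> \<rho> A = d0"
    using e0 mm0 finP finQ by (auto simp: sum_nonneg_eq_0_iff)
  have ne: "card (F J) \<ge> 1" if J: "J \<in> Q" for J
    using epos [OF J] eJ [OF J] finF [OF J] by (cases "F J = {}") (auto simp: Suc_le_eq card_gt_0_iff)
  have F1card: "card (F J) = 1" if J: "J \<in> Q" for J
  proof (rule ccontr)
    assume "card (F J) \<noteq> 1"
    with ne [OF J] have c2: "card (F J) \<ge> 2" by simp
    \<comment> \<open>Otherwise the strictness clause gives \<open>J\<close> positive slack. The
      inequality puts \<open>d0\<close> below every \<open>\<rho> A\<close>, so each
      \<open>A\<close> is saturated exactly once; then there are only \<open>card Q\<close>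
      saturated pairs, too few for a \<open>J\<close> with two.\<close>
    have "d_zero x P \<le> d_int x P"
    proof (rule ccontr)
      assume "\<not> ?thesis"
      then have "(\<Sum>A\<in>F J. col_rank x A) + d_zero x P < col_rank x J + card (F J) * d_zero x P"
        using F4 [OF J c2] by simp
      then have "e J > 0" unfolding e_def sumF unfolding \<rho>_def d0_def by linarith
      then show False using eJ [OF J] by simp
    qed
    then have "m A = 1" if "A \<in> P" for A
      using mA [OF that] dmin [OF that] di by (auto simp: \<rho>_def d0_def)
    then have "(\<Sum>J\<in>Q. int (card (F J))) = int (card P)"
      using swap [of "\<lambda>_. 1"] by simp
    then have "(\<Sum>J\<in>Q. int (card (F J)) - 1) = 0" using Q(2) by (simp add: sum_subtractf)
    moreover have "(\<Sum>J\<in>Q. int (card (F J)) - 1) > 0"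
      using ne J c2 finQ by (intro sum_pos2 [of _ J]) (auto simp: Suc_le_eq)
    ultimately show False by simp
  qed
  have "\<exists>A\<in>P. J \<subseteq> A" if J: "J \<in> Q" for J
  proof -
    obtain A where A: "F J = {A}" using F1card [OF J] by (rule card_1_singletonE)
    \<comment> \<open>For a single saturated segment, zero slack means equal ranks, the premise of
      the inclusion clause.\<close>
    then have "col_rank x J = col_rank x A" using eJ [OF J] by (simp add: e_def \<rho>_def)
    then show ?thesis using F3 [OF J A] FP [OF J] A by blast
  qed
  then show ?thesis
    using partition_on_refine_eq [OF fin part Q(1)] Q(2) by simp
qed

theorem theorem5:
  fixes x :: "nat \<Rightarrow> real ^ 'm" and n K d :: nat and P :: "nat set set"
  assumes "MSS x {1..n} P"
    and "card P = K"
    and "(\<Sum>A\<in>P. col_rank x A) = d"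
    and "\<forall>j\<in>{1..n}. \<forall>A\<in>P. \<forall>B\<in>P. A \<noteq> B \<longrightarrow> x j \<notin> col_space x A \<inter> col_space x B"
    and "intersected_nondegenerately x {1..n} P"
    and "d_int x P < d_min x P"
    and "d_zero x P \<le> d_min x P"
    and "\<forall>A\<in>P. card A > col_rank x A + (K - 1) * d_zero x P"
  shows "low_rank_partitions x {1..n} K d (d_min x P) = {P}"
proof -
  have part: "partition_on {1..n} P" using assms(1) by (simp add: MSS_def)
  have finP: "finite P" using finite_elements [OF _ part] by simp
  have "card A > d_min x P" if "A \<in> P" for A
  proof -
    have "d_min x P \<le> col_rank x A"
      unfolding d_min_def using finP that by (intro Min_le) auto
    also have "\<dots> < card A" using assms(8) that by fastforce
    finally show ?thesis .
  qed
  then have "P \<in> low_rank_partitions x {1..n} K d (d_min x P)"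
    using part assms(2,3) by (simp add: low_rank_partitions_def)
  moreover have "Q = P" if "Q \<in> low_rank_partitions x {1..n} K d (d_min x P)" for Q
    using that assms
    by (intro low_rank_partition_unique [OF _ part assms(4-7)]) (auto simp: low_rank_partitions_def)
  ultimately show ?thesis by blast
qed

end
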